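(* Let $(X,Y)$ be drawn from a data distribution $p(X,Y)$, where $X=(X_s,X_{ns})$ consists of a sensitive part $X_s$ and a non-sensitive part $X_{ns}$, and $Y$ takes values in the label set $\mathcal{Y}$. Fix a value $x_{ns}$ of the non-sensitive feature. Let $f_1$ and $f_2$ be two models such that for every label $y\in\mathcal{Y}$, $$U_{f_1}(x_{ns},y)\;\geq\; U_{f_2}(x_{ns},y).$$ Then for every label $y\in\mathcal{Y}$, $$S_{\mathrm{KL}}\big(p(X_s\mid y,x_{ns})\,\|\,p_{f_1}(X_s\mid y,x_{ns})\big)\;\geq\; S_{\mathrm{KL}}\big(p(X_s\mid y,x_{ns})\,\|\,p_{f_2}(X_s\mid y,x_{ns})\big).$$
   Context: Data: $(X,Y)\sim p(X,Y)$ with $X=(X_s,X_{ns})$ and $Y\in\mathcal{Y}$, where $\mathcal{Y}$ is a finite label set. The notations $p(X_s\mid x_{ns})$, $p(X_s\mid y,x_{ns})$ and $p(y\mid x_{ns})$ denote the conditional distributions (probability mass functions, or densities with respect to a fixed $\sigma$-finite reference measure on the space of sensitive features) induced by $p(X,Y)$. Model: a model $f$ assigns to each feature $(x_s,x_{ns})$ a probability distribution $p_f(\cdot\mid x_s,x_{ns})$ on $\mathcal{Y}$ (measurably in the feature). Induced quantities: for a model $f$ set $$p_f(y\mid x_{ns}) = E_{X_s\sim p(X_s\mid x_{ns})}\big[p_f(y\mid X_s,x_{ns})\big],\qquad p_f(x_s\mid y,x_{ns})=\frac{p_f(y\mid x_s,x_{ns})\,p(x_s\mid x_{ns})}{p_f(y\mid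 x_{ns})}.$$ That is, $p_f(X_s\mid y,x_{ns})\propto p_f(y\mid X_s,x_{ns})\,p(X_s\mid x_{ns})$ is the posterior of the sensitive feature obtained by Bayes' rule from the model $f$ and the true prior $p(X_s\mid x_{ns})$, and $p_f(y\mid x_{ns})$ is the corresponding normalizing constant. So that all these conditional distributions are defined, $p(y\mid x_{ns})>0$ and $p_{f_i}(y\mid x_{ns})>0$ for all $y\in\mathcal{Y}$ and $i=1,2$. Predictive power of the sensitive feature under $f$, given class $y$ and non-sensitive feature $x_{ns}$: $$U_f(x_{ns},y)=E_{X_s\sim p(X_s\mid y,x_{ns})}\big[\log p_f(y\mid X_s,x_{ns})-\log p_f(y\mid x_{ns})\big],$$ with the convention $\log 0=-\infty$, so $U_f(x_{ns},y)\in[-\infty,\infty)$. Similarity: $S_{\mathrm{KL}}(P\|Q)=-D_{\mathrm{KL}}(P\|Q)\in[-\infty,0]$ is the negative Kullback–Leibler divergence, where $D_{\mathrm{KL}}(P\|Q)=E_{x\sim P}[\log P(x)-\log Q(x)]$ (equal to $+\infty$ if $P$ is not absolutely continuous with respect to $Q$). *)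

theory Defs
  imports "HOL-Probability.Probability"
begin

section \<open>Extended-real logarithms and expectations\<close>

text \<open>Logarithm of a nonnegative real, with the convention \<open>log 0 = -\<infinity>\<close>.\<close>

definition elog :: "real \<Rightarrow> ereal" where
  "elog t = (if t = 0 then - \<infinity> else ereal (ln t))"

text \<open>
  Expectation of an extended-real function as (positive part) minus (negative part).
  Unlike the Bochner integral, which is \<open>0\<close> for non-integrable functions, it takes the values
  \<open>\<infinity>\<close> and \<open>-\<infinity>\<close>. The meaningless case \<open>\<infinity> - \<infinity>\<close> does not arise below: in the predictive power
  the positive part is bounded, and in the divergence the negative part has finite integral.
\<close>

definition eexpectation :: "'a measure \<Rightarrow> ('a \<Rightarrow> ereal) \<Rightarrow> ereal" where
  "eexpectation M g =
     enn2ereal (\<integral>\<^sup>+ x. e2ennreal (g x) \<partial>M) - enn2ereal (\<integral>\<^sup>+ x. e2ennreal (- g x) \<partial>M)"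

text \<open>
  Divergence and similarity of two distributions given by their densities \<open>p\<close>, \<open>q\<close> with respect
  to \<open>\<nu>\<close>. (The library's \<open>KL_divergence\<close> is real-valued and cannot express the value \<open>\<infinity>\<close>.)
\<close>

definition KL_div :: "'a measure \<Rightarrow> ('a \<Rightarrow> real) \<Rightarrow> ('a \<Rightarrow> real) \<Rightarrow> ereal" where
  "KL_div \<nu> p q =
     (if absolutely_continuous (density \<nu> (\<lambda>x. ennreal (q x))) (density \<nu> (\<lambda>x. ennreal (p x)))
      then eexpectation (density \<nu> (\<lambda>x. ennreal (p x))) (\<lambda>x. elog (p x) - elog (q x))
      else \<infinity>)"

definition S_KL :: "'a measure \<Rightarrow> ('a \<Rightarrow> real) \<Rightarrow> ('a \<Rightarrow> real) \<Rightarrow> ereal" where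
  "S_KL \<nu> p q = - KL_div \<nu> p q"


section \<open>Data distribution and its conditional distributions\<close>

text \<open>
  The joint law \<open>P\<close> of \<open>((X\<^sub>s, X\<^sub>n\<^sub>s), Y)\<close> lives on \<open>(\<nu> \<Otimes> N) \<Otimes> count_space UNIV\<close>, where \<open>\<nu>\<close> is the
  \<open>\<sigma>\<close>-finite reference measure on the sensitive features. Only the measurable structure of \<open>N\<close>
  is used. The function \<open>p\<close> is a version of the conditional density of \<open>(X\<^sub>s, Y)\<close> given \<open>X\<^sub>n\<^sub>s\<close>
  (with respect to \<open>\<nu>\<close> and counting measure): \<open>p x\<^sub>n\<^sub>s x\<^sub>s y\<close> stands for \<open>p(x\<^sub>s, y | x\<^sub>n\<^sub>s)\<close>.
  All conditional distributions at \<open>x\<^sub>n\<^sub>s\<close> are derived from this one version, hence are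
  mutually consistent even when \<open>x\<^sub>n\<^sub>s\<close> has marginal probability zero. If \<open>\<nu>\<close> is a counting
  measure, these are the usual conditional probability mass functions.
\<close>

definition marginal_ns :: "'n measure \<Rightarrow> (('s \<times> 'n) \<times> 'y) measure \<Rightarrow> 'n measure" where
  "marginal_ns N P = distr P N (\<lambda>((x\<^sub>s, x\<^sub>n\<^sub>s), y). x\<^sub>n\<^sub>s)"

definition data_distribution ::
  "'s measure \<Rightarrow> 'n measure \<Rightarrow> (('s \<times> 'n) \<times> 'y::finite) measure
     \<Rightarrow> ('n \<Rightarrow> 's \<Rightarrow> 'y \<Rightarrow> real) \<Rightarrow> bool" where
  "data_distribution \<nu> N P p \<longleftrightarrow>
     sigma_finite_measure \<nu> \<and>
     prob_space P \<and> sets P = sets ((\<nu> \<Otimes>\<^sub>M N) \<Otimes>\<^sub>M count_space UNIV) \<and>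
     (\<forall>y. (\<lambda>(x\<^sub>s, x\<^sub>n\<^sub>s). p x\<^sub>n\<^sub>s x\<^sub>s y) \<in> borel_measurable (\<nu> \<Otimes>\<^sub>M N)) \<and>
     (\<forall>x\<^sub>n\<^sub>s\<in>space N. \<forall>x\<^sub>s\<in>space \<nu>. \<forall>y. 0 \<le> p x\<^sub>n\<^sub>s x\<^sub>s y) \<and>
     (\<forall>x\<^sub>n\<^sub>s\<in>space N. (\<Sum>y\<in>UNIV. \<integral>\<^sup>+ x\<^sub>s. ennreal (p x\<^sub>n\<^sub>s x\<^sub>s y) \<partial>\<nu>) = 1) \<and>
     (\<forall>A\<in>sets \<nu>. \<forall>B\<in>sets N. \<forall>y.
        emeasure P ((A \<times> B) \<times> {y}) =
          (\<integral>\<^sup>+ x\<^sub>n\<^sub>s\<in>B. (\<integral>\<^sup>+ x\<^sub>s\<in>A. ennreal (p x\<^sub>n\<^sub>s x\<^sub>s y) \<partial>\<nu>) \<partial>marginal_ns N P))"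

text \<open>\<open>p(x\<^sub>s | x\<^sub>n\<^sub>s)\<close>, \<open>p(y | x\<^sub>n\<^sub>s)\<close> and \<open>p(x\<^sub>s | y, x\<^sub>n\<^sub>s)\<close>, respectively.\<close>

definition prior_s :: "('n \<Rightarrow> 's \<Rightarrow> 'y::finite \<Rightarrow> real) \<Rightarrow> 'n \<Rightarrow> 's \<Rightarrow> real" where
  "prior_s p x\<^sub>n\<^sub>s x\<^sub>s = (\<Sum>y\<in>UNIV. p x\<^sub>n\<^sub>s x\<^sub>s y)"

definition cond_label :: "'s measure \<Rightarrow> ('n \<Rightarrow> 's \<Rightarrow> 'y \<Rightarrow> real) \<Rightarrow> 'n \<Rightarrow> 'y \<Rightarrow> real" where
  "cond_label \<nu> p x\<^sub>n\<^sub>s y = (\<integral> x\<^sub>s. p x\<^sub>n\<^sub>s x\<^sub>s y \<partial>\<nu>)"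

definition posterior_s ::
  "'s measure \<Rightarrow> ('n \<Rightarrow> 's \<Rightarrow> 'y \<Rightarrow> real) \<Rightarrow> 'n \<Rightarrow> 'y \<Rightarrow> 's \<Rightarrow> real" where
  "posterior_s \<nu> p x\<^sub>n\<^sub>s y x\<^sub>s = p x\<^sub>n\<^sub>s x\<^sub>s y / cond_label \<nu> p x\<^sub>n\<^sub>s y"


section \<open>Models and induced quantities\<close>

definition is_model ::
  "'s measure \<Rightarrow> 'n measure \<Rightarrow> ('s \<times> 'n \<Rightarrow> 'y::finite pmf) \<Rightarrow> bool" where
  "is_model \<nu> N f \<longleftrightarrow> (\<forall>y. (\<lambda>x. pmf (f x) y) \<in> borel_measurable (\<nu> \<Otimes>\<^sub>M N))"

text \<open>
  The normalizing constant \<open>p\<^sub>f(y | x\<^sub>n\<^sub>s)\<close> and the density \<open>p\<^sub>f(x\<^sub>s | y, x\<^sub>n\<^sub>s)\<close>, obtained by Bayes'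
  rule from the model and the true prior \<open>p(x\<^sub>s | x\<^sub>n\<^sub>s)\<close>.
\<close>

definition model_label ::
  "'s measure \<Rightarrow> ('n \<Rightarrow> 's \<Rightarrow> 'y::finite \<Rightarrow> real) \<Rightarrow> ('s \<times> 'n \<Rightarrow> 'y pmf) \<Rightarrow> 'n \<Rightarrow> 'y \<Rightarrow> real" where
  "model_label \<nu> p f x\<^sub>n\<^sub>s y = (\<integral> x\<^sub>s. pmf (f (x\<^sub>s, x\<^sub>n\<^sub>s)) y \<partial>density \<nu> (\<lambda>x. ennreal (prior_s p x\<^sub>n\<^sub>s x)))"

definition model_posterior_s ::
  "'s measure \<Rightarrow> ('n \<Rightarrow> 's \<Rightarrow> 'y::finite \<Rightarrow> real) \<Rightarrow> ('s \<times> 'n \<Rightarrow> 'y pmf)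
     \<Rightarrow> 'n \<Rightarrow> 'y \<Rightarrow> 's \<Rightarrow> real" where
  "model_posterior_s \<nu> p f x\<^sub>n\<^sub>s y x\<^sub>s =
     pmf (f (x\<^sub>s, x\<^sub>n\<^sub>s)) y * prior_s p x\<^sub>n\<^sub>s x\<^sub>s / model_label \<nu> p f x\<^sub>n\<^sub>s y"

definition predictive_power ::
  "'s measure \<Rightarrow> ('n \<Rightarrow> 's \<Rightarrow> 'y::finite \<Rightarrow> real) \<Rightarrow> ('s \<times> 'n \<Rightarrow> 'y pmf) \<Rightarrow> 'n \<Rightarrow> 'y \<Rightarrow> ereal" where
  "predictive_power \<nu> p f x\<^sub>n\<^sub>s y =
     eexpectation (density \<nu> (\<lambda>x. ennreal (posterior_s \<nu> p x\<^sub>n\<^sub>s y x)))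
       (\<lambda>x\<^sub>s. elog (pmf (f (x\<^sub>s, x\<^sub>n\<^sub>s)) y) - elog (model_label \<nu> p f x\<^sub>n\<^sub>s y))"

end

theory Submission
  imports Defs
begin

text \<open>
  Up to normalization the posterior induced by a model is the model times the prior, so
  \<open>ln p(x\<^sub>s|y,x\<^sub>n\<^sub>s) - ln p\<^sub>f(x\<^sub>s|y,x\<^sub>n\<^sub>s)\<close> is the difference of
  \<open>ln p(x\<^sub>s|y,x\<^sub>n\<^sub>s) - ln p(x\<^sub>s|x\<^sub>n\<^sub>s)\<close>, which does not depend on the model, and of the integrand
  of the predictive power. The former is integrable: its positive part is bounded
  because the posterior is at most the prior divided by \<open>p(y|x\<^sub>n\<^sub>s)\<close>, its negative part is
  controlled by \<open>ln t \<ge> 1 - 1/t\<close>. Hence the divergence is a finite constant minus the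
  predictive power, with the infinite values matching as well.
\<close>

lemma eexpectation_cong_AE:
  assumes "AE x in M. g x = h x"
  shows "eexpectation M g = eexpectation M h"
proof -
  have "(\<integral>\<^sup>+ x. e2ennreal (g x) \<partial>M) = (\<integral>\<^sup>+ x. e2ennreal (h x) \<partial>M)"
    "(\<integral>\<^sup>+ x. e2ennreal (- g x) \<partial>M) = (\<integral>\<^sup>+ x. e2ennreal (- h x) \<partial>M)"
    by (intro nn_integral_cong_AE; use assms in eventually_elim; simp)+
  then show ?thesis
    by (simp add: eexpectation_def)
qed

lemma eexpectation_ereal:
  assumes "integrable M h"
  shows "eexpectation M (\<lambda>x. ereal (h x)) = ereal (\<integral>x. h x \<partial>M)"
proof -
  have fin: "(\<integral>\<^sup>+ x. ennreal (h x) \<partial>M) \<noteq> \<infinity>" "(\<integral>\<^sup>+ x. ennreal (- h x) \<partial>M) \<noteq> \<infinity>"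
    using assms by (auto simp: real_integrable_def)
  then obtain u v where "0 \<le> u" "(\<integral>\<^sup>+ x. ennreal (h x) \<partial>M) = ennreal u"
    "0 \<le> v" "(\<integral>\<^sup>+ x. ennreal (- h x) \<partial>M) = ennreal v"
    by (metis ennreal_cases infinity_ennreal_def)
  then show ?thesis
    using real_lebesgue_integral_def[OF assms]
    by (simp add: eexpectation_def e2ennreal_ereal)
qed

lemma eexpectation_eq_minf:
  assumes "(\<integral>\<^sup>+ x. e2ennreal (g x) \<partial>M) < \<infinity>" "(\<integral>\<^sup>+ x. e2ennreal (- g x) \<partial>M) = \<infinity>"
  shows "eexpectation M g = - \<infinity>"
proof -
  from assms(1) obtain u where "0 \<le> u" "(\<integral>\<^sup>+ x. e2ennreal (g x) \<partial>M) = ennreal u"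
    by (metis ennreal_cases infinity_ennreal_def less_irrefl)
  with assms(2) show ?thesis
    by (simp add: eexpectation_def)
qed

lemma eexpectation_eq_pinf:
  assumes "(\<integral>\<^sup>+ x. e2ennreal (- g x) \<partial>M) < \<infinity>" "(\<integral>\<^sup>+ x. e2ennreal (g x) \<partial>M) = \<infinity>"
  shows "eexpectation M g = \<infinity>"
proof -
  from assms(1) obtain u where "0 \<le> u" "(\<integral>\<^sup>+ x. e2ennreal (- g x) \<partial>M) = ennreal u"
    by (metis ennreal_cases infinity_ennreal_def less_irrefl)
  with assms(2) show ?thesis
    by (simp add: eexpectation_def)
qed

text \<open>\<open>ennreal\<close> sends negative reals to 0, so this is monotonicity and
  subadditivity of the positive part.\<close>

lemma ennreal_le_add:
  assumes "c \<le> a + b"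
  shows "ennreal c \<le> ennreal a + ennreal b"
proof -
  have "ennreal c \<le> ennreal (max 0 a + max 0 b)"
    using assms by (intro ennreal_leI) linarith
  also have "\<dots> = ennreal a + ennreal b"
    by (simp add: max_def ennreal_neg)
  finally show ?thesis .
qed

text \<open>If the negative part of \<open>g\<close> has infinite integral, the left side is
  +infinity and \<open>eexpectation M g\<close> is -infinity. Otherwise \<open>g\<close> is a.e.
  real and integrable, and linearity of the Bochner integral applies.\<close>

lemma eexpectation_diff:
  assumes a: "integrable M a" and g[measurable]: "g \<in> borel_measurable M"
    and pos: "(\<integral>\<^sup>+ x. e2ennreal (g x) \<partial>M) < \<infinity>"
  shows "eexpectation M (\<lambda>x. ereal (a x) - g x) = ereal (\<integral>x. a x \<partial>M) - eexpectation M g"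
proof (cases "(\<integral>\<^sup>+ x. e2ennreal (- g x) \<partial>M) = \<infinity>")
  case True
  have [measurable]: "a \<in> borel_measurable M"
    using a by auto
  have fin: "(\<integral>\<^sup>+ x. ennreal \<bar>a x\<bar> \<partial>M) < \<infinity>"
    using a by (simp add: integrable_iff_bounded)
  \<comment> \<open>The negative part of \<open>a - g\<close> is at most
    \<open>\<bar>a\<bar>\<close> plus the positive part of \<open>g\<close>, both of finite
    integral.\<close>
  have "e2ennreal (- (ereal (a x) - g x)) \<le> ennreal \<bar>a x\<bar> + e2ennreal (g x)" for x
  proof (cases "g x")
    case (real r)
    then show ?thesis
      by (auto simp: e2ennreal_ereal intro: ennreal_le_add)
  qed (auto simp: e2ennreal_neg)
  then have "(\<integral>\<^sup>+ x. e2ennreal (- (ereal (a x) - g x)) \<partial>M)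
      \<le> (\<integral>\<^sup>+ x. ennreal \<bar>a x\<bar> \<partial>M) + (\<integral>\<^sup>+ x. e2ennreal (g x) \<partial>M)"
    by (subst nn_integral_add[symmetric]) (auto intro!: nn_integral_mono)
  also have "\<dots> < \<infinity>"
    using fin pos by simp
  finally have neg: "(\<integral>\<^sup>+ x. e2ennreal (- (ereal (a x) - g x)) \<partial>M) < \<infinity>" .
  \<comment> \<open>Conversely, the negative part of \<open>g\<close> is at most the positive part
    of \<open>a - g\<close> plus \<open>\<bar>a\<bar>\<close>. As \<open>\<bar>a\<bar>\<close> has
    finite integral, the positive part of \<open>a - g\<close> must carry the infinity.\<close>
  have "e2ennreal (- g x) \<le> e2ennreal (ereal (a x) - g x) + ennreal \<bar>a x\<bar>" for x
  proof (cases "g x")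
    case (real r)
    then show ?thesis
      by (auto simp: e2ennreal_ereal intro: ennreal_le_add)
  qed (auto simp: e2ennreal_neg)
  then have "\<infinity> \<le> (\<integral>\<^sup>+ x. e2ennreal (ereal (a x) - g x) \<partial>M) + (\<integral>\<^sup>+ x. ennreal \<bar>a x\<bar> \<partial>M)"
    unfolding True[symmetric]
    by (subst nn_integral_add[symmetric]) (auto intro!: nn_integral_mono)
  with fin have "(\<integral>\<^sup>+ x. e2ennreal (ereal (a x) - g x) \<partial>M) = \<infinity>"
    by (auto simp: top_unique ennreal_add_eq_top)
  with neg show ?thesis
    using eexpectation_eq_pinf[of M "\<lambda>x. ereal (a x) - g x"] eexpectation_eq_minf[OF pos True]
    by simp
next
  case False
  \<comment> \<open>Finite integrals of both parts confine the values +infinity and -infinity to a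
    null set, so replacing them by 0 through \<open>real_of_ereal\<close> changes nothing.\<close>
  have "AE x in M. e2ennreal (g x) \<noteq> \<infinity>" "AE x in M. e2ennreal (- g x) \<noteq> \<infinity>"
    using nn_integral_PInf_AE[of "\<lambda>x. e2ennreal (g x)" M] nn_integral_PInf_AE[of "\<lambda>x. e2ennreal (- g x)" M]
      pos False by auto
  then have g_eq: "AE x in M. g x = ereal (real_of_ereal (g x))"
  proof eventually_elim
    case (elim x)
    then show ?case by (cases "g x") auto
  qed
  have "(\<integral>\<^sup>+ x. ennreal (real_of_ereal (g x)) \<partial>M) = (\<integral>\<^sup>+ x. e2ennreal (g x) \<partial>M)"
    "(\<integral>\<^sup>+ x. ennreal (- real_of_ereal (g x)) \<partial>M) = (\<integral>\<^sup>+ x. e2ennreal (- g x) \<partial>M)"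
    by (intro nn_integral_cong_AE; use g_eq in eventually_elim;
        metis e2ennreal_ereal uminus_ereal.simps(1))+
  then have h: "integrable M (\<lambda>x. real_of_ereal (g x))"
    using pos False by (auto simp: real_integrable_def)
  have "eexpectation M g = ereal (\<integral>x. real_of_ereal (g x) \<partial>M)"
    using eexpectation_cong_AE[OF g_eq] eexpectation_ereal[OF h] by simp
  moreover have "eexpectation M (\<lambda>x. ereal (a x) - g x)
      = eexpectation M (\<lambda>x. ereal (a x - real_of_ereal (g x)))"
    by (rule eexpectation_cong_AE, use g_eq in eventually_elim) (metis ereal_minus(1))
  moreover have "\<dots> = ereal (\<integral>x. a x - real_of_ereal (g x) \<partial>M)"
    using a h by (intro eexpectation_ereal) auto
  ultimately show ?thesis
    using a h by simp
qed

lemma borel_measurable_elog [measurable]: "elog \<in> borel_measurable borel"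
  unfolding elog_def[abs_def] by measurable

text \<open>Membership in \<open>space \<nu>\<close> is recorded as well, because sign conditions
  and bounds on the densities are assumed only there.\<close>

lemma AE_density_pos:
  fixes q :: "'a \<Rightarrow> real"
  assumes "q \<in> borel_measurable \<nu>"
  shows "AE x in density \<nu> (\<lambda>x. ennreal (q x)). x \<in> space \<nu> \<and> 0 < q x"
  using assms by (subst AE_density) (auto simp: ennreal_eq_0_iff not_less)

text \<open>On a null set of the \<open>s\<close>-measure, \<open>s\<close> is a.e. nonpositive;
  since \<open>s\<close> is positive a.e. where \<open>q\<close> is, \<open>q\<close> cannot be
  positive there either.\<close>

lemma absolutely_continuous_densityI:
  fixes q s :: "'a \<Rightarrow> real"
  assumes [measurable]: "q \<in> borel_measurable \<nu>" "s \<in> borel_measurable \<nu>"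
    and pos: "AE x in density \<nu> (\<lambda>x. ennreal (q x)). 0 < s x"
  shows "absolutely_continuous (density \<nu> (\<lambda>x. ennreal (s x))) (density \<nu> (\<lambda>x. ennreal (q x)))"
  unfolding absolutely_continuous_def
proof
  fix A assume "A \<in> null_sets (density \<nu> (\<lambda>x. ennreal (s x)))"
  then have A: "A \<in> sets \<nu>" "AE x in \<nu>. x \<in> A \<longrightarrow> s x \<le> 0"
    by (auto simp: null_sets_density_iff ennreal_eq_0_iff)
  have "AE x in \<nu>. 0 < q x \<longrightarrow> 0 < s x"
    using pos by (subst (asm) AE_density) auto
  with A(2) have "AE x in \<nu>. x \<in> A \<longrightarrow> ennreal (q x) = 0"
    by eventually_elim (auto simp: ennreal_eq_0_iff)
  with A(1) show "A \<in> null_sets (density \<nu> (\<lambda>x. ennreal (q x)))"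
    by (auto simp: null_sets_density_iff)
qed

lemma integrable_density_ln_ratio:
  fixes q r :: "'a \<Rightarrow> real"
  assumes q: "integrable \<nu> q" and r: "integrable \<nu> r"
    and q0: "\<And>x. x \<in> space \<nu> \<Longrightarrow> 0 \<le> q x"
    and r0: "\<And>x. x \<in> space \<nu> \<Longrightarrow> 0 \<le> r x"
    and C: "0 < C" "\<And>x. x \<in> space \<nu> \<Longrightarrow> q x \<le> C * r x"
  shows "integrable (density \<nu> (\<lambda>x. ennreal (q x))) (\<lambda>x. ln (q x / r x))"
proof -
  have [measurable]: "q \<in> borel_measurable \<nu>" "r \<in> borel_measurable \<nu>"
    using q r by auto
  have "integrable \<nu> (\<lambda>x. q x * ln (q x / r x))"
  \<comment> \<open>The term \<open>\<bar>ln C\<bar> * q x\<close> bounds the integrand above, since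
    \<open>q / r\<close> is at most \<open>C\<close>. The term \<open>r x\<close> bounds its
    negative: \<open>ln t \<le> t - 1\<close> at \<open>t = r / q\<close>, multiplied by
    \<open>q\<close>, gives \<open>r - q\<close>.\<close>
  proof (rule Bochner_Integration.integrable_bound[of _ "\<lambda>x. \<bar>ln C\<bar> * q x + r x"])
    show "AE x in \<nu>. norm (q x * ln (q x / r x)) \<le> norm (\<bar>ln C\<bar> * q x + r x)"
    proof (rule AE_I2)
      fix x assume x: "x \<in> space \<nu>"
      show "norm (q x * ln (q x / r x)) \<le> norm (\<bar>ln C\<bar> * q x + r x)"
      proof (cases "q x = 0")
        case False
        then have qp: "0 < q x" using q0[OF x] by simp
        then have rp: "0 < r x"
          using C(2)[OF x] r0[OF x] by (cases "r x = 0") auto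
        have "ln (q x / r x) \<le> ln C"
          using qp rp C(1) C(2)[OF x] by (subst ln_le_cancel_iff) (auto simp: divide_simps)
        then have "q x * ln (q x / r x) \<le> \<bar>ln C\<bar> * q x"
          using qp by (simp add: mult.commute)
        moreover have "ln (r x / q x) \<le> r x / q x - 1"
          using qp rp by (intro ln_le_minus_one) auto
        then have "q x * ln (r x / q x) \<le> q x * (r x / q x - 1)"
          using qp by (intro mult_left_mono) auto
        then have "q x * ln (r x / q x) \<le> r x - q x"
          using qp by (simp add: right_diff_distrib)
        then have "- (q x * ln (q x / r x)) \<le> r x"
          using qp rp by (simp add: ln_div right_diff_distrib)
        moreover have "0 \<le> \<bar>ln C\<bar> * q x"
          using qp by simp
        ultimately show ?thesis
          using rp unfolding real_norm_def by linarith
      qed simp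
    qed
  qed (use q r in auto)
  then show ?thesis
    using q0 by (subst integrable_density) auto
qed

text \<open>Here \<open>q\<close> stands for the true posterior, \<open>r\<close> for the prior,
  \<open>w\<close> for the model's probability of one label and \<open>m\<close> for the normalizing
  constant. Where \<open>q\<close>, \<open>r\<close> and \<open>w\<close> are positive, the
  logarithm of \<open>q / (w * r / m)\<close> splits into the two integrands on the right.\<close>

lemma KL_div_Bayes:
  fixes q r w :: "'a \<Rightarrow> real"
  assumes q: "integrable \<nu> q" and r: "integrable \<nu> r" and w[measurable]: "w \<in> borel_measurable \<nu>"
    and q0: "\<And>x. x \<in> space \<nu> \<Longrightarrow> 0 \<le> q x"
    and r0: "\<And>x. x \<in> space \<nu> \<Longrightarrow> 0 \<le> r x"
    and C: "0 < C" "\<And>x. x \<in> space \<nu> \<Longrightarrow> q x \<le> C * r x"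
    and w0: "\<And>x. 0 \<le> w x" and w1: "\<And>x. w x \<le> 1" and m: "0 < m"
  defines "D \<equiv> density \<nu> (\<lambda>x. ennreal (q x))"
  shows "KL_div \<nu> q (\<lambda>x. w x * r x / m)
    = ereal (\<integral>x. ln (q x / r x) \<partial>D) - eexpectation D (\<lambda>x. elog (w x) - elog m)"
proof -
  have [measurable]: "q \<in> borel_measurable \<nu>" "r \<in> borel_measurable \<nu>"
    using q r by auto
  define s where "s x = w x * r x / m" for x
  define g where "g x = elog (w x) - elog m" for x
  have [measurable]: "s \<in> borel_measurable \<nu>" "g \<in> borel_measurable D"
    unfolding s_def[abs_def] g_def[abs_def] D_def by measurable
  \<comment> \<open>As \<open>w\<close> is at most 1, \<open>g\<close> is at most
    \<open>- ln m\<close>; \<open>D\<close> has finite mass, so the positive part of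
    \<open>g\<close> has finite integral.\<close>
  have "e2ennreal (g x) \<le> ennreal \<bar>ln m\<bar>" for x
  proof (cases "w x = 0")
    case False
    then have "ln (w x) \<le> 0" using w0[of x] w1[of x] by simp
    then show ?thesis
      using False m by (auto simp: g_def elog_def e2ennreal_ereal intro!: ennreal_leI)
  qed (use m in \<open>simp add: g_def elog_def e2ennreal_neg\<close>)
  then have "(\<integral>\<^sup>+ x. e2ennreal (g x) \<partial>D) \<le> (\<integral>\<^sup>+ x. ennreal \<bar>ln m\<bar> \<partial>D)"
    by (intro nn_integral_mono)
  also have "\<dots> = ennreal \<bar>ln m\<bar> * (\<integral>\<^sup>+ x. ennreal (q x) \<partial>\<nu>)"
    unfolding D_def by (simp add: emeasure_density cong: nn_integral_cong)
  also have "\<dots> < \<infinity>"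
    using q by (auto simp: real_integrable_def ennreal_mult_less_top less_top)
  finally have gpos: "(\<integral>\<^sup>+ x. e2ennreal (g x) \<partial>D) < \<infinity>" .
  \<comment> \<open>\<open>D\<close> charges only points with \<open>q > 0\<close>, and there the
    domination by \<open>C * r\<close> forces \<open>r > 0\<close>.\<close>
  have supp: "AE x in D. 0 < q x \<and> 0 < r x"
    unfolding D_def using AE_density_pos[OF \<open>q \<in> borel_measurable \<nu>\<close>]
  proof eventually_elim
    case (elim x)
    then show ?case
      using C(2)[of x] r0[of x] by (cases "r x = 0") auto
  qed
  show ?thesis
  \<comment> \<open>This distinction decides absolute continuity: almost everywhere under
    \<open>D\<close>, \<open>s\<close> is positive exactly where \<open>w\<close> is. If it fails,
    both sides are +infinity.\<close>
  proof (cases "AE x in D. 0 < w x")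
    case True
    with supp have "AE x in D. 0 < s x"
      by eventually_elim (use m in \<open>simp add: s_def\<close>)
    then have "absolutely_continuous (density \<nu> (\<lambda>x. ennreal (s x))) D"
      unfolding D_def by (intro absolutely_continuous_densityI) auto
    then have "KL_div \<nu> q s = eexpectation D (\<lambda>x. elog (q x) - elog (s x))"
      by (simp add: KL_div_def D_def)
    also have "\<dots> = eexpectation D (\<lambda>x. ereal (ln (q x / r x)) - g x)"
      by (rule eexpectation_cong_AE, use supp True in eventually_elim)
        (use m in \<open>simp add: s_def g_def elog_def ln_div ln_mult\<close>)
    also have "\<dots> = ereal (\<integral>x. ln (q x / r x) \<partial>D) - eexpectation D g"
      unfolding D_def
      by (intro eexpectation_diff integrable_density_ln_ratio[OF q r q0 r0 C])
        (use gpos in \<open>auto simp: D_def[symmetric]\<close>)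
    finally show ?thesis
      by (simp add: s_def[abs_def] g_def[abs_def])
  next
    case False
    have "\<not> absolutely_continuous (density \<nu> (\<lambda>x. ennreal (s x))) D"
    proof
      assume "absolutely_continuous (density \<nu> (\<lambda>x. ennreal (s x))) D"
      \<comment> \<open>The \<open>s\<close>-measure charges only points with \<open>s > 0\<close>;
        absolute continuity passes this on to \<open>D\<close>.\<close>
      then have "AE x in D. 0 < s x"
        by (rule absolutely_continuous_AE[rotated]) (use AE_density_pos[of s \<nu>] in \<open>auto simp: D_def\<close>)
      then have "AE x in D. 0 < w x"
        by eventually_elim (use w0 in \<open>force simp: s_def less_le\<close>)
      with False show False ..
    qed
    \<comment> \<open>If this integral were finite, \<open>- g\<close> would be finite a.e.; but
      \<open>- g\<close> is +infinity wherever \<open>w\<close> vanishes.\<close>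
    moreover have "(\<integral>\<^sup>+ x. e2ennreal (- g x) \<partial>D) = \<infinity>"
    proof (rule ccontr)
      assume "(\<integral>\<^sup>+ x. e2ennreal (- g x) \<partial>D) \<noteq> \<infinity>"
      then have "AE x in D. e2ennreal (- g x) \<noteq> \<infinity>"
        by (intro nn_integral_PInf_AE) auto
      then have "AE x in D. 0 < w x"
        by eventually_elim (use w0 m in \<open>force simp: g_def elog_def less_le\<close>)
      with False show False ..
    qed
    then have "eexpectation D g = - \<infinity>"
      by (rule eexpectation_eq_minf[OF gpos])
    ultimately show ?thesis
      by (simp add: KL_div_def D_def s_def[abs_def] g_def[abs_def])
  qed
qed

text \<open>The first term on the right involves only the data, so it is a real constant common to
  all models.\<close>

lemma KL_div_model_posterior:
  fixes f :: "'s \<times> 'n \<Rightarrow> 'y::finite pmf"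
  assumes data: "data_distribution \<nu> N P p" and f: "is_model \<nu> N f" and x: "x\<^sub>n\<^sub>s \<in> space N"
    and c: "cond_label \<nu> p x\<^sub>n\<^sub>s y > 0" and m: "model_label \<nu> p f x\<^sub>n\<^sub>s y > 0"
  shows "KL_div \<nu> (posterior_s \<nu> p x\<^sub>n\<^sub>s y) (model_posterior_s \<nu> p f x\<^sub>n\<^sub>s y)
    = ereal (\<integral>x. ln (posterior_s \<nu> p x\<^sub>n\<^sub>s y x / prior_s p x\<^sub>n\<^sub>s x)
        \<partial>density \<nu> (\<lambda>x. ennreal (posterior_s \<nu> p x\<^sub>n\<^sub>s y x)))
      - predictive_power \<nu> p f x\<^sub>n\<^sub>s y"
proof -
  have sec: "(\<lambda>x\<^sub>s. (x\<^sub>s, x\<^sub>n\<^sub>s)) \<in> \<nu> \<rightarrow>\<^sub>M \<nu> \<Otimes>\<^sub>M N"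
    using x by simp
  have meas: "(\<lambda>x\<^sub>s. p x\<^sub>n\<^sub>s x\<^sub>s y) \<in> borel_measurable \<nu>" for y
    using data measurable_compose[OF sec, of "\<lambda>(x\<^sub>s, x\<^sub>n\<^sub>s). p x\<^sub>n\<^sub>s x\<^sub>s y"]
    by (simp add: data_distribution_def)
  have nonneg: "0 \<le> p x\<^sub>n\<^sub>s x\<^sub>s y" if "x\<^sub>s \<in> space \<nu>" for x\<^sub>s y
    using data x that by (simp add: data_distribution_def)
  have int: "integrable \<nu> (\<lambda>x\<^sub>s. p x\<^sub>n\<^sub>s x\<^sub>s y)" for y
  proof (rule integrableI_nonneg[OF meas])
    have "(\<integral>\<^sup>+ x\<^sub>s. ennreal (p x\<^sub>n\<^sub>s x\<^sub>s y) \<partial>\<nu>) \<le> (\<Sum>y\<in>UNIV. \<integral>\<^sup>+ x\<^sub>s. ennreal (p x\<^sub>n\<^sub>s x\<^sub>s y) \<partial>\<nu>)"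
      by (rule member_le_sum) auto
    also have "\<dots> = 1"
      using data x by (simp add: data_distribution_def)
    finally show "(\<integral>\<^sup>+ x\<^sub>s. ennreal (p x\<^sub>n\<^sub>s x\<^sub>s y) \<partial>\<nu>) < \<infinity>"
      by (auto simp: less_top[symmetric] top_unique)
  qed (use nonneg in auto)
  \<comment> \<open>For each label the joint density is one nonnegative summand of the prior;
    dividing by the label probability yields the constant \<open>C\<close> used below.\<close>
  have "posterior_s \<nu> p x\<^sub>n\<^sub>s y z \<le> 1 / cond_label \<nu> p x\<^sub>n\<^sub>s y * prior_s p x\<^sub>n\<^sub>s z" if "z \<in> space \<nu>" for z
    unfolding posterior_s_def prior_s_def
    using member_le_sum[of y UNIV "p x\<^sub>n\<^sub>s z"] nonneg[OF that] c by (simp add: divide_right_mono)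
  moreover have "(\<lambda>x\<^sub>s. pmf (f (x\<^sub>s, x\<^sub>n\<^sub>s)) y) \<in> borel_measurable \<nu>"
    using f measurable_compose[OF sec, of "\<lambda>x. pmf (f x) y"] by (simp add: is_model_def)
  moreover have "integrable \<nu> (posterior_s \<nu> p x\<^sub>n\<^sub>s y)" "integrable \<nu> (prior_s p x\<^sub>n\<^sub>s)"
    unfolding posterior_s_def[abs_def] prior_s_def[abs_def] using int by auto
  moreover have "0 \<le> posterior_s \<nu> p x\<^sub>n\<^sub>s y z" "0 \<le> prior_s p x\<^sub>n\<^sub>s z" if "z \<in> space \<nu>" for z
    using nonneg[OF that] c by (auto simp: posterior_s_def prior_s_def intro!: sum_nonneg)
  ultimately show ?thesis
    unfolding predictive_power_def model_posterior_s_def[abs_def]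
    using c m by (intro KL_div_Bayes[where C="1 / cond_label \<nu> p x\<^sub>n\<^sub>s y"]) (auto simp: pmf_le_1)
qed

theorem theorem1:
  fixes \<nu> :: "'s measure" and N :: "'n measure"
    and P :: "(('s \<times> 'n) \<times> 'y::finite) measure"
    and p :: "'n \<Rightarrow> 's \<Rightarrow> 'y \<Rightarrow> real"
    and f\<^sub>1 f\<^sub>2 :: "'s \<times> 'n \<Rightarrow> 'y pmf"
    and x\<^sub>n\<^sub>s :: 'n
  assumes "data_distribution \<nu> N P p"
    and "is_model \<nu> N f\<^sub>1" and "is_model \<nu> N f\<^sub>2"
    and "x\<^sub>n\<^sub>s \<in> space N"
    and "\<And>y. cond_label \<nu> p x\<^sub>n\<^sub>s y > 0"
    and "\<And>y. model_label \<nu> p f\<^sub>1 x\<^sub>n\<^sub>s y > 0"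
    and "\<And>y. model_label \<nu> p f\<^sub>2 x\<^sub>n\<^sub>s y > 0"
    and "\<And>y. predictive_power \<nu> p f\<^sub>1 x\<^sub>n\<^sub>s y \<ge> predictive_power \<nu> p f\<^sub>2 x\<^sub>n\<^sub>s y"
  shows "\<forall>y. S_KL \<nu> (posterior_s \<nu> p x\<^sub>n\<^sub>s y) (model_posterior_s \<nu> p f\<^sub>1 x\<^sub>n\<^sub>s y)
           \<ge> S_KL \<nu> (posterior_s \<nu> p x\<^sub>n\<^sub>s y) (model_posterior_s \<nu> p f\<^sub>2 x\<^sub>n\<^sub>s y)"
  unfolding S_KL_def
  \<comment> \<open>Subtracting the predictive power from the common constant reverses the order,
    and the sign in \<open>S_KL\<close> restores it.\<close>
  using assms by (simp add: KL_div_model_posterior ereal_minus_mono)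

end
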